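(* Let $F>0$ and let $C,P:[0,\infty)\to\mathbb{R}$ be call and put price functions of the strike satisfying the static no-arbitrage conditions in the lognormal setting listed in the context. Let $0<K_1<K_2$, let $k_i=\log(K_i/F)$, and let $v_i=v(k_i)>0$ be the corresponding total Black--Scholes implied volatilities, $i=1,2$. Then $$\frac{k_1}{v_1}<\frac{k_2}{v_2}.$$
   Context: A single maturity is fixed, the discount factor is one, and $F>0$ is the forward price. $C(K)$ and $P(K)$ are undiscounted European call and put prices with strike $K$. "Increasing" and "decreasing" without "strictly" are meant in the weak sense. Static no-arbitrage conditions (lognormal setting): (1) $C$ is decreasing and convex in $K$; (2) $P$ is increasing and convex in $K$; (3) put--call parity: $C(K)-P(K)=F-K$ for all $K$; (4) boundary conditions: $C(0)=F$ and $\lim_{K\to\infty}C(K)=0$. $\Phi$ is the standard normal distribution function. For a strike $K>0$ write $k=\log(K/F)$. The total Black--Scholes implied volatility $v(k)>0$ is the number $v>0$ such that, with $z=k/v$, $$\frac{C(K)}{F}=\Phi\!\left(-z+\frac v2\right)-e^{vz}\,\Phi\!\left(-z-\frac v2\right),$$ equivalently (by put--call parity) $$\frac{P(K)}{K}=\Phi\!\left(z+\frac v2\right)-e^{-vz}\,\Phi\!\left(z-\frac v2\right).$$ *)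

theory Defs
  imports "HOL-Probability.Probability"
begin

abbreviation Phi :: "real \<Rightarrow> real"
  where "Phi \<equiv> cdf std_normal_distribution"

text \<open>
  Price functions on \<open>[0, \<infinity>)\<close> are modelled as functions \<open>real \<Rightarrow> real\<close> that are constrained
  only on \<open>{0..}\<close>; their values at negative strikes are irrelevant.
\<close>

definition static_no_arbitrage_lognormal ::
    "real \<Rightarrow> (real \<Rightarrow> real) \<Rightarrow> (real \<Rightarrow> real) \<Rightarrow> bool"
  where "static_no_arbitrage_lognormal F C P \<longleftrightarrow>
    antimono_on {0..} C \<and> convex_on {0..} C \<and>
    mono_on {0..} P \<and> convex_on {0..} P \<and>
    (\<forall>K\<ge>0. C K - P K = F - K) \<and>
    C 0 = F \<and> (C \<longlongrightarrow> 0) at_top"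

text \<open>The Black--Scholes call price divided by the forward, with \<open>z = k / v\<close>.\<close>

definition bs_normalised_call :: "real \<Rightarrow> real \<Rightarrow> real"
  where "bs_normalised_call k v =
    (let z = k / v in Phi (- z + v / 2) - exp (v * z) * Phi (- z - v / 2))"

text \<open>
  The total implied volatility is given as a relation rather than a function, because
  no-arbitrage prices with zero time value have no positive implied volatility.
\<close>

definition is_total_implied_vol :: "real \<Rightarrow> (real \<Rightarrow> real) \<Rightarrow> real \<Rightarrow> real \<Rightarrow> bool"
  where "is_total_implied_vol F C K v \<longleftrightarrow>
    v > 0 \<and> C K / F = bs_normalised_call (ln (K / F)) v"

end

theory Submission
  imports Defs "HOL-Real_Asymp.Real_Asymp"
begin

text \<open>
  In the coordinates \<open>z = k / v\<close> and \<open>v\<close>, the call price per unit of forward is \<open>f z v\<close> and, by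
  symmetry, the put price per unit of strike is \<open>f (- z) v\<close>, for the same function \<open>f\<close>. For
  \<open>z > 0\<close>, \<open>f\<close> decreases in \<open>z\<close> and strictly increases in \<open>v\<close>; the latter is the Mills ratio
  bound. Suppose \<open>z1 \<ge> z2\<close> although \<open>v1 * z1 < v2 * z2\<close>. If \<open>z2 > 0\<close>, then \<open>v1 < v2\<close> and the
  call price would strictly increase from \<open>K1\<close> to \<open>K2\<close>. If \<open>z2 \<le> 0\<close>, then \<open>z1 < 0\<close> and
  \<open>v2 < v1\<close>, and \<open>P K / K\<close> would strictly decrease, although \<open>P\<close> is convex with \<open>P 0 = 0\<close>.
\<close>

lemma Phi_nonneg: "0 \<le> Phi x"
  by (simp add: cdf_def)

lemma Phi_tendsto_0_at_bot: "(Phi \<longlongrightarrow> 0) at_bot"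
proof -
  interpret real_distribution std_normal_distribution by (rule real_dist_normal_dist)
  show ?thesis by (rule cdf_lim_at_bot)
qed

lemma Phi_tendsto_1_at_top: "(Phi \<longlongrightarrow> 1) at_top"
proof -
  interpret real_distribution std_normal_distribution by (rule real_dist_normal_dist)
  show ?thesis by (rule cdf_lim_at_top_prob)
qed

lemma continuous_on_std_normal_density: "continuous_on S std_normal_density"
  unfolding std_normal_density_def by (intro continuous_intros) auto

lemma Phi_diff_eq_integral:
  assumes "a \<le> x"
  shows "Phi x - Phi a = integral {a..x} std_normal_density"
proof (cases "a = x")
  case False
  interpret real_distribution std_normal_distribution by (rule real_dist_normal_dist)
  have si: "set_integrable lborel {a..x} std_normal_density"
    by (intro borel_integrable_atLeastAtMost' continuous_on_std_normal_density)
  then have si': "set_integrable lborel {a<..x} std_normal_density"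
    by (rule set_integrable_subset) auto
  have "Phi x - Phi a = measure std_normal_distribution {a<..x}"
    using assms False by (intro cdf_diff_eq) auto
  also have "\<dots> = (LINT t|std_normal_distribution. indicator {a<..x} t)"
    by simp
  also have "\<dots> = (LINT t:{a<..x}|lborel. std_normal_density t)"
    by (subst integral_real_density) (auto simp: set_lebesgue_integral_def mult.commute)
  also have "\<dots> = integral {a<..x} std_normal_density"
    by (rule set_borel_integral_eq_integral(2)[OF si'])
  also have "\<dots> = integral {a..x} std_normal_density"
    by (rule integral_spike_set; rule negligible_subset[of "{a}"]) auto
  finally show ?thesis .
qed simp

lemma DERIV_Phi: "(Phi has_real_derivative std_normal_density x) (at x)"
proof -
  \<comment> \<open>Starting the integral at \<open>x - 1\<close> puts \<open>x\<close> in the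
    interior of the interval, so the one-sided fundamental theorem yields a two-sided
    derivative.\<close>
  let ?I = "\<lambda>y. Phi (x - 1) + integral {x - 1..y} std_normal_density"
  have "(?I has_real_derivative 0 + std_normal_density x) (at x within {x - 1..x + 1})"
    by (intro derivative_intros integral_has_real_derivative continuous_on_std_normal_density) auto
  moreover have "at x within {x - 1..x + 1} = at x"
    by (rule at_within_interior) simp
  ultimately have "(?I has_real_derivative std_normal_density x) (at x)"
    by simp
  then show ?thesis
  proof (rule DERIV_cong_ev[THEN iffD1, rotated -1])
    show "\<forall>\<^sub>F y in nhds x. ?I y = Phi y"
      using eventually_nhds_in_open[of "{x - 1<..}" x]
    proof (rule eventually_mono)
      fix y assume "y \<in> {x - 1<..}"
      then show "?I y = Phi y"
        using Phi_diff_eq_integral[of "x - 1" y] by simp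
    qed auto
  qed auto
qed

lemmas DERIV_Phi_chain [derivative_intros] = DERIV_chain2[OF DERIV_Phi]

lemma DERIV_std_normal_density:
  "(std_normal_density has_real_derivative - x * std_normal_density x) (at x)"
  unfolding std_normal_density_def by (auto intro!: derivative_eq_intros simp: field_simps)

lemma std_normal_density_minus: "std_normal_density (- x) = std_normal_density x"
  by (simp add: std_normal_density_def)

text \<open>The density is even, so \<open>?s\<close> has derivative zero; its limit at infinity
  identifies the constant.\<close>

lemma Phi_minus: "Phi (- x) = 1 - Phi x"
proof -
  let ?s = "\<lambda>x. Phi x + Phi (- x)"
  have const: "?s x = ?s y" for x y
    by (rule DERIV_isconst_all)
       (auto intro!: derivative_eq_intros simp: std_normal_density_minus)
  have "(?s \<longlongrightarrow> 1 + 0) at_top"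
    by (intro tendsto_add Phi_tendsto_1_at_top
        filterlim_compose[OF Phi_tendsto_0_at_bot filterlim_uminus_at_bot_at_top])
  moreover have "?s = (\<lambda>_. ?s x)"
    using const by blast
  ultimately have "((\<lambda>_. ?s x) \<longlongrightarrow> 1) (at_top :: real filter)"
    by simp
  then have "?s x = 1"
    by (simp add: tendsto_const_iff)
  then show ?thesis by simp
qed

text \<open>The gap \<open>?m\<close> tends to 0 at minus infinity and has a positive derivative on
  the negative axis, so it is positive at \<open>d\<close>.\<close>

lemma mills_ratio_less:
  assumes "d < 0"
  shows "- d * Phi d < std_normal_density d"
proof -
  let ?m = "\<lambda>x. - (std_normal_density x / x) - Phi x"
  have "0 < ?m d"
  proof (rule DERIV_pos_imp_increasing_at_bot[where f = ?m])
    fix x :: real assume "x \<le> d"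
    with assms have "x < 0" by simp
    then have "(?m has_real_derivative std_normal_density x / x\<^sup>2) (at x)"
      by (auto intro!: derivative_eq_intros DERIV_std_normal_density
          simp: field_simps power2_eq_square)
    with \<open>x < 0\<close> show "\<exists>y. (?m has_real_derivative y) (at x) \<and> 0 < y"
      by (intro exI[of _ "std_normal_density x / x\<^sup>2"])
         (auto intro!: divide_pos_pos normal_density_pos)
  next
    have "((\<lambda>x. std_normal_density x / x) \<longlongrightarrow> 0) at_bot"
      unfolding std_normal_density_def by real_asymp
    then show "(?m \<longlongrightarrow> 0) at_bot"
      using tendsto_diff[OF tendsto_minus Phi_tendsto_0_at_bot] by fastforce
  qed
  with assms show ?thesis
    by (simp add: field_simps)
qed

text \<open>The \<open>f\<close> of the overview: \<open>z\<close> is a free variable here, so that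
  \<open>z\<close> and \<open>v\<close> can be varied separately.\<close>

definition bs_scaled_call :: "real \<Rightarrow> real \<Rightarrow> real"
  where "bs_scaled_call z v = Phi (- z + v / 2) - exp (v * z) * Phi (- z - v / 2)"

lemma bs_normalised_call_eq: "bs_normalised_call k v = bs_scaled_call (k / v) v"
  by (simp add: bs_normalised_call_def bs_scaled_call_def Let_def)

text \<open>If \<open>v * z = ln (K / F)\<close>, then \<open>exp (- (v * z))\<close> is
  \<open>F / K\<close>, and parity makes the right-hand side the put price per unit of
  strike.\<close>

lemma bs_scaled_put_call_parity:
  "bs_scaled_call (- z) v = 1 - exp (- (v * z)) + exp (- (v * z)) * bs_scaled_call z v"
proof -
  have "Phi (z + v / 2) = 1 - Phi (- z - v / 2)" "Phi (z - v / 2) = 1 - Phi (- z + v / 2)"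
    using Phi_minus[of "- z - v / 2"] Phi_minus[of "- z + v / 2"] by (simp_all add: add.commute)
  then have "bs_scaled_call (- z) v
      = 1 - Phi (- z - v / 2) - exp (- (v * z)) * (1 - Phi (- z + v / 2))"
    by (simp add: bs_scaled_call_def)
  moreover have "exp (- (v * z)) * bs_scaled_call z v
      = exp (- (v * z)) * Phi (- z + v / 2) - Phi (- z - v / 2)"
    by (simp add: bs_scaled_call_def right_diff_distrib flip: mult.assoc exp_add)
  ultimately show ?thesis by (simp add: right_diff_distrib)
qed

text \<open>The squares of the two arguments differ by \<open>2 * v * z\<close>. Hence the density
  terms cancel in the \<open>z\<close>-derivative of \<open>bs_scaled_call\<close> and merge into
  one in its \<open>v\<close>-derivative.\<close>

lemma std_normal_density_d1_d2:
  "std_normal_density (- z + v / 2) = exp (v * z) * std_normal_density (- z - v / 2)"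
  by (simp add: std_normal_density_def field_simps power2_eq_square flip: exp_add)

lemma bs_scaled_call_antimono:
  assumes "z \<le> z'" "v \<ge> 0"
  shows "bs_scaled_call z' v \<le> bs_scaled_call z v"
  unfolding bs_scaled_call_def using assms(1)
proof (rule DERIV_nonpos_imp_nonincreasing)
  fix z :: real
  let ?f = "\<lambda>z. Phi (- z + v / 2) - exp (v * z) * Phi (- z - v / 2)"
  have "(?f has_real_derivative - (v * exp (v * z) * Phi (- z - v / 2))) (at z)"
    by (auto intro!: derivative_eq_intros
        simp: std_normal_density_d1_d2 [simplified])
  then show "\<exists>y. (?f has_real_derivative y) (at z) \<and> y \<le> 0"
    using \<open>v \<ge> 0\<close> Phi_nonneg by (intro exI conjI) auto
qed

lemma bs_scaled_call_strict_mono: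
  assumes "z > 0" "0 < v" "v < v'"
  shows "bs_scaled_call z v < bs_scaled_call z v'"
  unfolding bs_scaled_call_def using assms(3)
proof (rule DERIV_pos_imp_increasing)
  fix w :: real assume "v \<le> w"
  let ?f = "\<lambda>w. Phi (- z + w / 2) - exp (w * z) * Phi (- z - w / 2)"
  let ?d = "- z - w / 2"
  have "(?f has_real_derivative exp (w * z) * (std_normal_density ?d - z * Phi ?d)) (at w)"
    by (auto intro!: derivative_eq_intros
        simp: std_normal_density_d1_d2 [simplified] algebra_simps)
  \<comment> \<open>The term \<open>z * Phi ?d\<close> competes with the density, because
    \<open>exp (w * z)\<close> also varies with \<open>w\<close>. As \<open>z\<close> is at most
    \<open>- ?d\<close>, the Mills bound at \<open>?d\<close> dominates it.\<close>
  moreover have "z * Phi ?d \<le> - ?d * Phi ?d"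
    using assms \<open>v \<le> w\<close> Phi_nonneg by (intro mult_right_mono) auto
  with mills_ratio_less[of ?d] assms \<open>v \<le> w\<close>
  have "0 < exp (w * z) * (std_normal_density ?d - z * Phi ?d)"
    by simp
  ultimately show "\<exists>y. (?f has_real_derivative y) (at w) \<and> 0 < y"
    by blast
qed

text \<open>First \<open>z\<close> is lowered to \<open>z'\<close> at fixed \<open>v\<close>, then
  \<open>v\<close> is raised at fixed \<open>z'\<close>. This serves calls directly and puts after
  negating \<open>z\<close>.\<close>

lemma bs_scaled_call_less:
  assumes "0 < z'" "z' \<le> z" "0 < v" "v < v'"
  shows "bs_scaled_call z v < bs_scaled_call z' v'"
  using bs_scaled_call_antimono[of z' z v] bs_scaled_call_strict_mono[of z' v v'] assms by simp

text \<open>Parity at strike 0 gives \<open>P 0 = 0\<close>, so the quotient is the slope of a chord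
  of \<open>P\<close> from the origin, which convexity makes monotone.\<close>

lemma no_arbitrage_put_div_strike_mono:
  assumes "static_no_arbitrage_lognormal F C P" "0 < K1" "K1 \<le> K2"
  shows "P K1 / K1 \<le> P K2 / K2"
proof -
  have "convex_on {0..} P" "C 0 - P 0 = F - 0" "C 0 = F"
    using assms(1) by (auto simp: static_no_arbitrage_lognormal_def)
  then have "P ((1 - K1 / K2) *\<^sub>R 0 + (K1 / K2) *\<^sub>R K2) \<le> (1 - K1 / K2) * P 0 + (K1 / K2) * P K2"
    using assms by (intro convex_onD) auto
  with \<open>C 0 - P 0 = F - 0\<close> \<open>C 0 = F\<close> show ?thesis
    using assms by (simp add: field_simps)
qed

lemma implied_vol_call:
  assumes "is_total_implied_vol F C K v"
  shows "C K / F = bs_scaled_call (ln (K / F) / v) v"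
  using assms by (simp add: is_total_implied_vol_def bs_normalised_call_eq)

lemma implied_vol_put:
  assumes "F > 0" "K > 0" "static_no_arbitrage_lognormal F C P" "is_total_implied_vol F C K v"
  shows "P K / K = bs_scaled_call (- (ln (K / F) / v)) v"
proof -
  have "v > 0"
    using assms by (simp add: is_total_implied_vol_def)
  then have "exp (- (v * (ln (K / F) / v))) = F / K"
    using assms by (simp add: exp_minus)
  moreover have "P K = C K - F + K"
    using assms by (auto simp: static_no_arbitrage_lognormal_def algebra_simps)
  ultimately show ?thesis
    using assms(1,2)
    by (simp only: bs_scaled_put_call_parity implied_vol_call[OF assms(4), symmetric])
       (simp add: field_simps)
qed

theorem theorem4p3:
  fixes F K1 K2 k1 k2 v1 v2 :: real and C P :: "real \<Rightarrow> real"
  assumes "F > 0"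
    and "static_no_arbitrage_lognormal F C P"
    and "0 < K1" and "K1 < K2"
    and "k1 = ln (K1 / F)" and "k2 = ln (K2 / F)"
    and "is_total_implied_vol F C K1 v1"
    and "is_total_implied_vol F C K2 v2"
  shows "k1 / v1 < k2 / v2"
proof (rule ccontr)
  define z1 z2 where "z1 = k1 / v1" and "z2 = k2 / v2"
  assume "\<not> k1 / v1 < k2 / v2"
  then have z: "z2 \<le> z1" by (simp add: z1_def z2_def)
  have v: "v1 > 0" "v2 > 0"
    using assms by (auto simp: is_total_implied_vol_def)
  have "k1 < k2"
    using assms by (simp add: divide_strict_right_mono)
  then have k: "v1 * z1 < v2 * z2"
    using v by (simp add: z1_def z2_def)
  show False
  proof (cases "z2 > 0")
    case True
    \<comment> \<open>In \<open>v1 * z2 \<le> v1 * z1 < v2 * z2\<close> the positive factor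
      \<open>z2\<close> cancels.\<close>
    have "v1 * z2 \<le> v1 * z1"
      using z v by simp
    with k have "v1 * z2 < v2 * z2" by simp
    with True have "v1 < v2" by simp
    with True z v have "C K1 / F < C K2 / F"
      using bs_scaled_call_less[of z2 z1 v1 v2] implied_vol_call assms by (simp add: z1_def z2_def)
    moreover have "C K2 \<le> C K1"
      using assms by (auto simp: static_no_arbitrage_lognormal_def monotone_on_def)
    ultimately show False
      using \<open>F > 0\<close> by (simp add: divide_less_cancel)
  next
    case False
    with v have "v2 * z2 \<le> 0"
      by (simp add: mult_nonneg_nonpos)
    with k have "v1 * z1 < 0" by simp
    with v have "z1 < 0" by (simp add: mult_less_0_iff)
    \<comment> \<open>Here the common factor is the negative \<open>z1\<close>: cancelling it in
      \<open>v1 * z1 < v2 * z2 \<le> v2 * z1\<close> reverses the order. The put at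
      \<open>K2\<close> thus has the smaller \<open>v\<close> and the larger
      \<open>- z\<close>.\<close>
    have "v2 * z2 \<le> v2 * z1"
      using z v by simp
    with k have "v1 * z1 < v2 * z1" by simp
    with \<open>z1 < 0\<close> have "v2 < v1" by simp
    with \<open>z1 < 0\<close> z v have "P K2 / K2 < P K1 / K1"
      using bs_scaled_call_less[of "- z1" "- z2" v2 v1] implied_vol_put assms
      by (simp add: z1_def z2_def)
    moreover have "P K1 / K1 \<le> P K2 / K2"
      using assms by (intro no_arbitrage_put_div_strike_mono) auto
    ultimately show False by simp
  qed
qed

end
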